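(* Let $r\ge 2$ and $s\ge 1$ be integers and let $G$ be a $K_{2,r}$-free graph with $\chi(G)\ge (rs)^s$. Then for every optimal coloring of $G$, every tree on $s$ vertices is present as an induced rainbow subgraph of $G$.
   Context: Graphs are finite and simple. $G$ is $K_{2,r}$-free if it has no subgraph (not necessarily induced) isomorphic to $K_{2,r}$. An optimal coloring is a proper vertex coloring using exactly $\chi(G)$ colors. An induced rainbow subgraph is an induced subgraph whose vertices receive pairwise distinct colors. *)

theory Defs
  imports "Graph_Theory.Graph_Theory"
begin

text \<open>
  Finite simple graphs are rendered by the locale predicate \<open>pair_graph\<close>: finite, loop-free,
  symmetric digraphs whose arcs are pairs, so that an edge \<open>uv\<close> is the pair of arcs
  \<open>(u, v)\<close>, \<open>(v, u)\<close>.
\<close>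

text \<open>
  The library predicate \<open>complete_bipartite_digraph m n H\<close> says that \<open>H\<close> is isomorphic to
  \<open>K\<^sub>m\<^sub>,\<^sub>n\<close>; \<open>subgraph\<close> is the not necessarily induced notion.
\<close>

definition K2_free :: "nat \<Rightarrow> 'a pair_pre_digraph \<Rightarrow> bool" where
  "K2_free r G \<longleftrightarrow>
    \<not> (\<exists>H :: 'a pair_pre_digraph. subgraph (with_proj H) (with_proj G)
          \<and> complete_bipartite_digraph 2 r (with_proj H))"

text \<open>
  The library predicates \<open>forest\<close> and \<open>tree\<close> are meant for directed graphs: they regard the walk
  \<open>u, v, u\<close> along a single edge as a cycle. A cycle of an undirected graph has length at least 3.
\<close>

definition undirected_tree :: "'a pair_pre_digraph \<Rightarrow> bool" where
  "undirected_tree T \<longleftrightarrow> pair_graph T \<and> connected (with_proj T)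
    \<and> \<not> (\<exists>p. pre_digraph.cycle (with_proj T) p \<and> 3 \<le> length p)"

definition proper_coloring :: "'a pair_pre_digraph \<Rightarrow> ('a \<Rightarrow> 'c) \<Rightarrow> bool" where
  "proper_coloring G c \<longleftrightarrow> (\<forall>(u, v) \<in> parcs G. c u \<noteq> c v)"

definition chromatic_number :: "'a pair_pre_digraph \<Rightarrow> nat" where
  "chromatic_number G =
    (LEAST k. \<exists>c :: 'a \<Rightarrow> nat. proper_coloring G c \<and> c ` pverts G \<subseteq> {..<k})"

definition optimal_coloring :: "'a pair_pre_digraph \<Rightarrow> ('a \<Rightarrow> 'c) \<Rightarrow> bool" where
  "optimal_coloring G c \<longleftrightarrow>
    proper_coloring G c \<and> card (c ` pverts G) = chromatic_number G"

definition has_induced_rainbow ::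
    "'a pair_pre_digraph \<Rightarrow> ('a \<Rightarrow> 'c) \<Rightarrow> 't pair_pre_digraph \<Rightarrow> bool" where
  "has_induced_rainbow G c T \<longleftrightarrow>
    (\<exists>H :: 'a pair_pre_digraph. induced_subgraph (with_proj H) (with_proj G)
        \<and> digraph_iso (with_proj T) (with_proj H) \<and> inj_on c (pverts H))"

end

theory Submission
  imports Defs
begin

text \<open>
  Fix an optimal coloring with color set \<open>{..<k}\<close> and a rooted tree on the colors. If \<open>l\<close> is a leaf
  with parent \<open>p\<close>, then the vertices of color \<open>l\<close> together with those vertices of color \<open>p\<close> that have
  no neighbor of color \<open>l\<close> form an independent set; deleting it lowers the chromatic number by at
  most one, and every remaining vertex of color \<open>p\<close> has a neighbor of color \<open>l\<close>. By induction
  the tree occurs in the graph with every node \<open>i\<close> placed on a vertex of color \<open>i\<close>.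

  Apply this to the complete \<open>d\<close>-ary tree with \<open>d = r * s\<close>, numbered like a heap (the children of \<open>i\<close>
  are \<open>d * i + 1, \<dots>, d * i + d\<close>), and embed \<open>T\<close> into it greedily. When \<open>j < s\<close> vertices are placed and
  the next one is to be attached at \<open>a\<close>, the \<open>d\<close> children of \<open>a\<close> are available; at most \<open>j\<close> of them are
  used already, and at most \<open>(j - 1) * (r - 1)\<close> of them are adjacent to a used vertex other than \<open>a\<close>,
  because two vertices of a \<open>K\<^sub>2\<^sub>,\<^sub>r\<close>-free graph have fewer than \<open>r\<close> common neighbors.
\<close>

section \<open>Trees with prescribed colors from a chromatic lower bound\<close>

text \<open>The set \<open>V\<close> varies while \<open>E\<close> and \<open>c\<close> stay fixed,
  because the induction deletes vertices. Parents have smaller numbers than their children, so the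
  node with the largest number is a leaf.\<close>

lemma ex_colorful_rooted_tree:
  fixes E :: "'a rel" and c :: "'a \<Rightarrow> nat" and par :: "nat \<Rightarrow> nat"
  assumes "sym E"
    and "\<And>i. 0 < i \<Longrightarrow> i < n \<Longrightarrow> par i < i"
    and "\<And>u v. u \<in> V \<Longrightarrow> v \<in> V \<Longrightarrow> (u, v) \<in> E \<Longrightarrow> c u \<noteq> c v"
    and "c ` V \<subseteq> {..<n}"
    and "\<And>k (c' :: 'a \<Rightarrow> nat). k < n \<Longrightarrow> c' ` V \<subseteq> {..<k} \<Longrightarrow>
           \<exists>u\<in>V. \<exists>v\<in>V. (u, v) \<in> E \<and> c' u = c' v"
  shows "\<exists>f. \<forall>i<n. f i \<in> V \<and> c (f i) = i \<and> (0 < i \<longrightarrow> (f (par i), f i) \<in> E)"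
  using assms(2-)
proof (induction n arbitrary: V)
  case 0
  then show ?case by simp
next
  case (Suc n)
  note proper = Suc.prems(2) and range = Suc.prems(3) and chrom = Suc.prems(4)
  show ?case
  proof (cases "n = 0")
    case True
    then have "V \<noteq> {}" using chrom[of 0] by auto
    then obtain v where "v \<in> V" by blast
    with range True show ?thesis by (intro exI[of _ "\<lambda>_. v"]) auto
  next
    case False
    define W where "W = {v \<in> V. c v \<noteq> n \<and> (c v = par n \<longrightarrow> (\<exists>w\<in>V. (v, w) \<in> E \<and> c w = n))}"
    have sub: "W \<subseteq> V" by (auto simp: W_def)
    have indep: "(u, v) \<notin> E" if "u \<in> V - W" "v \<in> V - W" for u v
      using that proper[of u v] \<open>sym E\<close> by (auto simp: W_def dest: symD)
    have "\<exists>f. \<forall>i<n. f i \<in> W \<and> c (f i) = i \<and> (0 < i \<longrightarrow> (f (par i), f i) \<in> E)"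
    proof (rule Suc.IH)
      show "par i < i" if "0 < i" "i < n" for i using Suc.prems(1) that by simp
      show "c u \<noteq> c v" if "u \<in> W" "v \<in> W" "(u, v) \<in> E" for u v
        using that proper sub by blast
      show "c ` W \<subseteq> {..<n}" using range by (fastforce simp: W_def less_Suc_eq)
      show "\<exists>u\<in>W. \<exists>v\<in>W. (u, v) \<in> E \<and> c' u = c' v"
        if "k < n" "c' ` W \<subseteq> {..<k}" for k and c' :: "'a \<Rightarrow> nat"
      proof -
        \<comment> \<open>All deleted vertices share the fresh color \<open>k\<close>. They are
          independent, so a monochromatic edge of \<open>c''\<close> must lie inside
          \<open>W\<close>.\<close>
        define c'' where "c'' v = (if v \<in> W then c' v else k)" for v
        have "c'' ` V \<subseteq> {..<Suc k}" using that by (auto simp: c''_def image_subset_iff less_Suc_eq)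
        then obtain u v where "u \<in> V" "v \<in> V" "(u, v) \<in> E" "c'' u = c'' v"
          using chrom[of "Suc k" c''] \<open>k < n\<close> by auto
        then show ?thesis
          using indep[of u v] that(2) by (auto simp: c''_def image_subset_iff split: if_splits)
      qed
    qed
    then obtain f where f: "\<forall>i<n. f i \<in> W \<and> c (f i) = i \<and> (0 < i \<longrightarrow> (f (par i), f i) \<in> E)"
      by blast
    have par: "par n < n" using Suc.prems(1) False by simp
    \<comment> \<open>\<open>f (par n)\<close> has color \<open>par n\<close> and survived the
      deletion, so it has a neighbor of color \<open>n\<close>, on which the leaf is placed.\<close>
    then obtain w where "w \<in> V" "(f (par n), w) \<in> E" "c w = n"
      using f by (fastforce simp: W_def)
    moreover have "par i \<noteq> n" if "0 < i" "i < n" for i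
      using Suc.prems(1)[of i] that by simp
    ultimately show ?thesis
      using f sub par by (intro exI[of _ "f(n := w)"]) (auto simp: less_Suc_eq)
  qed
qed

section \<open>Common neighbors\<close>

lemma card_common_neighbors_less:
  assumes "pair_graph G" "0 < r" "K2_free r G" "a \<noteq> b"
  shows "card {x. (a, x) \<in> parcs G \<and> (b, x) \<in> parcs G} < r"
proof (rule ccontr)
  interpret pair_graph G by fact
  assume "\<not> ?thesis"
  then obtain Y where Y: "Y \<subseteq> {x. (a, x) \<in> parcs G \<and> (b, x) \<in> parcs G}" "card Y = r" "finite Y"
    by (meson linorder_not_less obtain_subset_with_card_n)
  \<comment> \<open>A common neighbor is what shows that \<open>a\<close> and \<open>b\<close> are
    vertices of \<open>G\<close>.\<close>
  then have "Y \<noteq> {}" using \<open>0 < r\<close> by auto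
  define H where "H = \<lparr>pverts = {a, b} \<union> Y, parcs = {a, b} \<times> Y \<union> Y \<times> {a, b}\<rparr>"
  have "pverts H \<subseteq> pverts G" "parcs H \<subseteq> parcs G"
    using Y(1) \<open>Y \<noteq> {}\<close> by (auto simp: H_def intro: arcs_symmetric dest: in_arcsD1 in_arcsD2)
  moreover have "pair_wf_digraph H" "pair_wf_digraph G" by unfold_locales (auto simp: H_def)
  ultimately have "subgraph (with_proj H) (with_proj G)"
    by (auto simp: subgraph_def compatible_def wf_digraph_wp_iff)
  moreover have "{a, b} \<inter> Y = {}" using Y(1) no_loops' by auto
  then have "complete_bipartite_digraph 2 r (with_proj H)"
    unfolding complete_bipartite_digraph_pair_def using Y(2,3) \<open>a \<noteq> b\<close>
    by (intro conjI exI[of _ "{a, b}"] exI[of _ Y]) (auto simp: H_def)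
  ultimately show False using \<open>K2_free r G\<close> by (auto simp: K2_free_def)
qed

section \<open>Growing a tree by leaves\<close>

text \<open>By connectedness some arc leaves every nonempty proper vertex subset. If the subset is
  itself connected, a second neighbor of the new vertex in it would close a cycle.\<close>

lemma undirected_tree_induct [consumes 1, case_names singleton insert]:
  assumes "undirected_tree T"
    and singleton: "\<And>v. v \<in> pverts T \<Longrightarrow> P {v}"
    and insert: "\<And>S u v. S \<subseteq> pverts T \<Longrightarrow> P S \<Longrightarrow> u \<in> S \<Longrightarrow> v \<in> pverts T - S \<Longrightarrow> (u, v) \<in> parcs T \<Longrightarrow>
      (\<And>w. w \<in> S \<Longrightarrow> (w, v) \<in> parcs T \<Longrightarrow> w = u) \<Longrightarrow> P (insert v S)"
  shows "P (pverts T)"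
proof -
  interpret pair_graph T using assms(1) by (simp add: undirected_tree_def)
  have acyclic: "\<not> (cycle p \<and> 3 \<le> length p)" for p
    using assms(1) by (auto simp: undirected_tree_def)
  have strong: "strongly_connected (with_proj T)"
    using assms(1) symmetric_connected_imp_strongly_connected sym_arcs by (auto simp: undirected_tree_def)
  define conn where
    "conn S \<longleftrightarrow> (\<forall>u\<in>S. \<forall>w\<in>S. \<exists>p. apath u p w \<and> set (pawalk_verts u p) \<subseteq> S)" for S
  have snoc: "awalk x (p @ [(y, z)]) z \<and> pawalk_verts x (p @ [(y, z)]) = pawalk_verts x p @ [z]"
    if "apath x p y" "(y, z) \<in> parcs T" for x p y z
  proof -
    have "awalk x p y" using that(1) by (simp add: apath_def)
    moreover have "awalk y [(y, z)] z" using that(2) by (auto simp: awalk_simps dest: in_arcsD2)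
    ultimately have walk: "awalk x (p @ [(y, z)]) z" by (rule awalk_appendI)
    show ?thesis using walk awalk_verts_append[OF walk] by simp
  qed
  have "\<exists>S. S \<subseteq> pverts T \<and> card S = Suc j \<and> P S \<and> conn S" if "Suc j \<le> card (pverts T)" for j
    using that
  proof (induction j)
    case 0
    then obtain v where v: "v \<in> pverts T" by fastforce
    moreover have "conn {v}"
      using v unfolding conn_def by (auto simp: apath_Nil_iff intro!: exI[of _ "[]"])
    ultimately show ?case using singleton by (intro exI[of _ "{v}"]) auto
  next
    case (Suc j)
    then obtain S where S: "S \<subseteq> pverts T" "card S = Suc j" "P S" "conn S" by auto
    then have fin: "finite S" by (auto intro: card_ge_0_finite)
    have "S \<noteq> pverts T" "S \<noteq> {}" using S Suc.prems by auto
    then obtain a b where "a \<in> S" and b: "b \<in> pverts T - S" using S(1) by blast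
    have "\<exists>u\<in>S. \<exists>v. v \<notin> S \<and> (u, v) \<in> parcs T"
    \<comment> \<open>Otherwise \<open>S\<close> is closed under arcs, so \<open>b\<close> is not
      reachable from \<open>a\<close>.\<close>
    proof (rule ccontr)
      assume closed: "\<not> ?thesis"
      have "a \<rightarrow>\<^sup>*\<^bsub>with_proj T\<^esub> b"
        using strong \<open>a \<in> S\<close> b S(1) by (auto simp: strongly_connected_def)
      then have "b \<in> S"
        by (induction rule: reachable_induct) (use \<open>a \<in> S\<close> closed in auto)
      with b show False by simp
    qed
    then obtain u v where uv: "u \<in> S" "v \<notin> S" "(u, v) \<in> parcs T" by blast
    then have v: "v \<in> pverts T" by (auto dest: in_arcsD2)
    have vu: "(v, u) \<in> parcs T" using uv by (auto intro: arcs_symmetric)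
    have uniq: "w = u" if w: "w \<in> S" "(w, v) \<in> parcs T" for w
    proof (rule ccontr)
      assume "w \<noteq> u"
      obtain p where p: "apath u p w" "set (pawalk_verts u p) \<subseteq> S"
        using S(4) uv(1) w(1) unfolding conn_def by blast
      have "p \<noteq> []" using p(1) \<open>w \<noteq> u\<close> by (auto simp: apath_Nil_iff)
      have p': "awalk u (p @ [(w, v)]) v" "pawalk_verts u (p @ [(w, v)]) = pawalk_verts u p @ [v]"
        using snoc[OF p(1) w(2)] by auto
      \<comment> \<open>The path \<open>p\<close> stays in \<open>S\<close> and so avoids
        \<open>v\<close>. It is nonempty since \<open>w \<noteq> u\<close>, which makes the cycle at
        least 3 long.\<close>
      have "cycle ((v, u) # p @ [(w, v)])"
        using p p' uv(2) vu unfolding cycle_def by (intro exI[of _ v]) (auto simp: awalk_Cons_iff apath_def)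
      with acyclic \<open>p \<noteq> []\<close> show False by (cases p) fastforce+
    qed
    have "conn (insert v S)"
      unfolding conn_def
    proof (intro ballI)
      fix x y assume xy: "x \<in> insert v S" "y \<in> insert v S"
      consider "x = v" "y = v" | "x = v" "y \<in> S" | "x \<in> S" "y = v" | "x \<in> S" "y \<in> S"
        using xy by blast
      then show "\<exists>p. apath x p y \<and> set (pawalk_verts x p) \<subseteq> insert v S"
      proof cases
        case 1
        then show ?thesis using v by (intro exI[of _ "[]"]) (auto simp: apath_Nil_iff)
      next
        case 2
        then obtain p where "apath u p y" "set (pawalk_verts u p) \<subseteq> S"
          using S(4) uv(1) unfolding conn_def by blast
        then show ?thesis using 2 vu uv(2)
          by (intro exI[of _ "(v, u) # p"]) (auto simp: apath_Cons_iff)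
      next
        case 3
        then obtain p where "apath x p u" "set (pawalk_verts x p) \<subseteq> S"
          using S(4) uv(1) unfolding conn_def by blast
        then show ?thesis using 3 snoc[of x p u v] uv
          by (intro exI[of _ "p @ [(u, v)]"]) (auto simp: apath_def)
      next
        case 4
        then show ?thesis using S(4) by (fastforce simp: conn_def)
      qed
    qed
    moreover have "P (insert v S)" using insert[OF S(1,3) uv(1) _ uv(3)] uniq v uv(2) by blast
    ultimately show ?case
      using S v uv(2) fin by (intro exI[of _ "insert v S"]) auto
  qed
  moreover have "card (pverts T) \<noteq> 0"
    using strong by (auto simp: strongly_connected_def)
  ultimately obtain S where "S \<subseteq> pverts T" "card S = card (pverts T)" "P S"
    by (metis Suc_pred' le_refl neq0_conv)
  then show ?thesis using card_subset_eq[OF pair_finite_verts] by auto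
qed


section \<open>Greedy induced embedding into the heap\<close>

text \<open>Among the vertices \<open>f i\<close> only the arcs between parents and children are
  guaranteed; further arcs may exist, so the greedy choice has to avoid unwanted
  adjacencies.\<close>

lemma ex_induced_copy_in_heap:
  assumes "pair_graph G" "0 < r" "K2_free r G"
    and "undirected_tree T" "card (pverts T) = s" "2 \<le> r * s" "(r * s) ^ s \<le> k"
    and "inj_on f {..<k}"
    and heap: "\<And>i. 0 < i \<Longrightarrow> i < k \<Longrightarrow> (f ((i - 1) div (r * s)), f i) \<in> parcs G"
  shows "\<exists>h. inj_on h (pverts T) \<and> h ` pverts T \<subseteq> f ` {..<k} \<and>
    (\<forall>u\<in>pverts T. \<forall>w\<in>pverts T. (u, w) \<in> parcs T \<longleftrightarrow> (h u, h w) \<in> parcs G)"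
proof -
  interpret G: pair_graph G by fact
  interpret T: pair_graph T using assms(4) by (simp add: undirected_tree_def)
  define d where "d = r * s"
  have d2: "2 \<le> d" using assms(6) by (simp add: d_def)
  have level: "2 * d ^ (j - 1) \<le> k" if "1 \<le> j" "j \<le> s" for j
  proof -
    have "2 * d ^ (j - 1) \<le> d * d ^ (j - 1)" using d2 by simp
    also have "\<dots> = d ^ j" using that(1) by (cases j) auto
    also have "\<dots> \<le> d ^ s" using d2 that(2) by (intro power_increasing) auto
    also have "\<dots> \<le> k" using assms(7) by (simp add: d_def)
    finally show ?thesis .
  qed
  \<comment> \<open>The first \<open>j\<close> levels of the heap lie in \<open>N j\<close>, and \<open>N s\<close> fits into the \<open>k\<close> available nodes.\<close>
  define N where "N j = {i. i + 2 \<le> 2 * d ^ (j - 1)}" for j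
  have N_k: "N j \<subseteq> {..<k}" if "1 \<le> j" "j \<le> s" for j using level[OF that] by (auto simp: N_def)
  have N_mono: "N j \<subseteq> N (Suc j)" for j
  proof -
    have "d ^ (j - 1) \<le> d ^ j" using d2 by (intro power_increasing) auto
    then show ?thesis by (auto simp: N_def)
  qed
  \<comment> \<open>Each insertion goes at most one level deeper, so \<open>card S\<close> bounds
    the depth and no actual depth needs tracking.\<close>
  define good where "good S h \<longleftrightarrow> inj_on h S \<and> h ` S \<subseteq> f ` N (card S) \<and>
    (\<forall>u\<in>S. \<forall>w\<in>S. (u, w) \<in> parcs T \<longleftrightarrow> (h u, h w) \<in> parcs G)" for S h
  have "\<exists>h. good (pverts T) h"
    using assms(4)
  proof (induction rule: undirected_tree_induct)
    case (singleton v)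
    \<comment> \<open>The first vertex goes to the root: \<open>N 1\<close> contains only
      \<open>0\<close>.\<close>
    show ?case
      using T.no_loops' G.no_loops' by (intro exI[of _ "\<lambda>_. f 0"]) (auto simp: good_def N_def)
  next
    case (insert S u v)
    then obtain h where h: "good S h" by blast
    define j where "j = card S"
    have fin: "finite S" using insert.hyps(1) T.pair_finite_verts finite_subset by blast
    have "card (insert v S) \<le> card (pverts T)"
      using insert.hyps(1,3) by (intro card_mono T.pair_finite_verts) auto
    then have js: "Suc j \<le> s" using insert.hyps(3) fin assms(5) by (simp add: j_def)
    have j1: "1 \<le> j" using insert.hyps(2) fin by (auto simp: j_def Suc_le_eq card_gt_0_iff)
    obtain i where i: "i \<in> N j" "h u = f i" using h insert.hyps(2) by (auto simp: good_def j_def)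
    \<comment> \<open>The offset 2 in \<open>N\<close> makes the bound pass to children:
      \<open>d * i + d + 2 \<le> d * (i + 2)\<close> because \<open>2 \<le> d\<close>.\<close>
    have NS: "d * i + e \<in> N (Suc j)" if "e \<le> d" for e
    proof -
      have "d * i + e + 2 \<le> d * (i + 1) + d"  using that d2 by (simp add: algebra_simps)
      also have "\<dots> = d * (i + 2)" by (simp add: algebra_simps)
      also have "\<dots> \<le> d * (2 * d ^ (j - 1))" using i(1) by (intro mult_left_mono) (auto simp: N_def)
      also have "\<dots> = 2 * d ^ j" using j1 by (cases j) auto
      finally show ?thesis by (simp add: N_def)
    qed
    define X where "X = (\<lambda>e. f (d * i + e)) ` {1..d}"
    \<comment> \<open>The forbidden vertices: a child of \<open>h u\<close> that is also adjacent to
      \<open>h w\<close> is a common neighbor of the two.\<close>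
    define B where
      "B = h ` S \<union> (\<Union>w\<in>S - {u}. {x. (h u, x) \<in> parcs G \<and> (h w, x) \<in> parcs G})"
    have finB: "finite {x. (h u, x) \<in> parcs G \<and> (h w, x) \<in> parcs G}" for w
      using G.pair_finite_verts by (rule rev_finite_subset) (auto dest: G.in_arcsD2)
    have "inj_on (\<lambda>e. f (d * i + e)) {1..d}"
      using assms(8) NS N_k[OF _ js] by (fastforce simp: inj_on_def)
    then have "card X = d" by (simp add: X_def card_image)
    have "card B \<le> card (h ` S) + (\<Sum>w\<in>S - {u}. card {x. (h u, x) \<in> parcs G \<and> (h w, x) \<in> parcs G})"
      unfolding B_def using fin by (intro order.trans[OF card_Un_le] add_left_mono card_UN_le) auto
    also have "\<dots> \<le> j + (\<Sum>w\<in>S - {u}. r - 1)"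
    proof (intro add_mono sum_mono)
      show "card (h ` S) \<le> j" using fin by (simp add: j_def card_image_le)
      show "card {x. (h u, x) \<in> parcs G \<and> (h w, x) \<in> parcs G} \<le> r - 1" if "w \<in> S - {u}" for w
      proof -
        have "h u \<noteq> h w" using h that insert.hyps(2) by (auto simp: good_def inj_on_def)
        then show ?thesis using card_common_neighbors_less[OF assms(1-3)] by fastforce
      qed
    qed
    also have "\<dots> = j + (j - 1) * (r - 1)" using insert.hyps(2) by (simp add: j_def)
    also have "\<dots> \<le> j + j * (r - 1)" by simp
    also have "\<dots> = r * j" using assms(2) by (cases r) auto
    also have "\<dots> < d" using js assms(2) by (simp add: d_def)
    finally have "card B < card X" using \<open>card X = d\<close> by simp
    moreover have "finite B" using fin finB by (auto simp: B_def)
    ultimately have "\<not> X \<subseteq> B" using card_mono[of B X] by linarith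
    then obtain e where e: "1 \<le> e" "e \<le> d" "f (d * i + e) \<notin> B"
      unfolding X_def image_subset_iff by (metis atLeastAtMost_iff)
    define x where "x = f (d * i + e)"
    \<comment> \<open>Children are counted from \<open>e = 1\<close>, so \<open>e - 1 < d\<close>
      leaves the quotient at the parent \<open>i\<close>.\<close>
    have "(d * i + e - 1) div d = i"
    proof -
      have "d * i + e - 1 = (e - 1) + d * i" using e(1) by simp
      also have "\<dots> div d = i" using e d2 by (subst div_mult_self2) auto
      finally show ?thesis .
    qed
    then have ux: "(h u, x) \<in> parcs G"
      using heap[of "d * i + e"] e NS[OF e(2)] N_k[OF _ js] i(2) by (auto simp: d_def x_def)
    \<comment> \<open>Both sides hold for \<open>w = u\<close>. For other \<open>w\<close> the left
      fails as \<open>x \<notin> B\<close>, the right as \<open>u\<close> is the only neighbor of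
      \<open>v\<close> in \<open>S\<close>.\<close>
    have adj: "(h w, x) \<in> parcs G \<longleftrightarrow> (w, v) \<in> parcs T" if "w \<in> S" for w
      using that e(3) ux insert.hyps(4,5) by (auto simp: B_def x_def)
    have "good (insert v S) (h(v := x))"
      unfolding good_def
    proof (intro conjI)
      have "inj_on h S" "x \<notin> h ` S" using h e(3) by (auto simp: good_def B_def x_def)
      then show "inj_on (h(v := x)) (insert v S)"
        using insert.hyps(3) by (auto intro: inj_on_fun_updI)
      have "h ` S \<subseteq> f ` N (Suc j)"
        using h image_mono[OF N_mono[of j], of f] unfolding good_def j_def by blast
      moreover have "x \<in> f ` N (Suc j)" using NS[OF e(2)] by (simp add: x_def)
      moreover have "card (insert v S) = Suc j" using insert.hyps(3) fin by (simp add: j_def)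
      ultimately show "(h(v := x)) ` insert v S \<subseteq> f ` N (card (insert v S))"
        using insert.hyps(3) by auto
      have adj': "(x, h w) \<in> parcs G \<longleftrightarrow> (v, w) \<in> parcs T" if "w \<in> S" for w
        using adj[OF that] G.arcs_symmetric T.arcs_symmetric by blast
      show "\<forall>a\<in>insert v S. \<forall>b\<in>insert v S.
          (a, b) \<in> parcs T \<longleftrightarrow> ((h(v := x)) a, (h(v := x)) b) \<in> parcs G"
      proof (intro ballI)
        fix a b assume "a \<in> insert v S" "b \<in> insert v S"
        moreover have "(x, x) \<notin> parcs G" "(v, v) \<notin> parcs T"
          using G.no_loops' T.no_loops' by blast+
        moreover have "(a, b) \<in> parcs T \<longleftrightarrow> (h a, h b) \<in> parcs G" if "a \<in> S" "b \<in> S"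
          using h that by (simp add: good_def)
        ultimately show "(a, b) \<in> parcs T \<longleftrightarrow> ((h(v := x)) a, (h(v := x)) b) \<in> parcs G"
          using adj[of a] adj'[of b] by (cases "a = v"; cases "b = v") simp_all
      qed
    qed
    then show ?case by blast
  qed
  then obtain h where h: "good (pverts T) h" by blast
  then have "h ` pverts T \<subseteq> f ` N s" using assms(5) by (simp add: good_def)
  moreover have "1 \<le> s" using assms(6) by (cases s) auto
  then have "f ` N s \<subseteq> f ` {..<k}" by (intro image_mono N_k) auto
  ultimately have "h ` pverts T \<subseteq> f ` {..<k}" by (rule subset_trans)
  with h show ?thesis by (intro exI[of _ h]) (simp add: good_def)
qed

section \<open>From vertex maps to induced rainbow copies\<close>

lemma has_induced_rainbowI:
  assumes "pair_graph G" "pair_graph T" "inj_on h (pverts T)" "h ` pverts T \<subseteq> pverts G"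
    and "\<And>u w. u \<in> pverts T \<Longrightarrow> w \<in> pverts T \<Longrightarrow> (u, w) \<in> parcs T \<longleftrightarrow> (h u, h w) \<in> parcs G"
    and "inj_on c (h ` pverts T)"
  shows "has_induced_rainbow G c T"
proof -
  interpret G: pair_graph G by fact
  interpret T: pair_graph T by fact
  define A where "A = parcs G \<inter> h ` pverts T \<times> h ` pverts T"
  define H where "H = \<lparr>pverts = h ` pverts T, parcs = A\<rparr>"
  \<comment> \<open>Arcs are pairs of endpoints, so the vertex map determines the arc map.\<close>
  define iso where "iso = \<lparr>iso_verts = h, iso_arcs = map_prod h h, iso_head = snd, iso_tail = fst\<rparr>"
  have "pair_wf_digraph H" by unfold_locales (auto simp: H_def A_def)
  then have "induced_subgraph (with_proj H) (with_proj G)"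
    using assms(4) G.pair_wf_digraph
    by (auto simp: induced_subgraph_def subgraph_def compatible_def wf_digraph_wp_iff H_def A_def)
  moreover have inj_arcs: "inj_on (map_prod h h) (parcs T)"
    using map_prod_inj_on[OF assms(3,3)] by (rule inj_on_subset) (auto dest: T.in_arcsD1 T.in_arcsD2)
  have "T.digraph_isomorphism iso"
    unfolding T.digraph_isomorphism_def
    using assms(3) inj_arcs T.wf_digraph_axioms by (auto simp: iso_def)
  moreover have "A = map_prod h h ` parcs T"
    using assms(5) by (fastforce simp: A_def dest: T.in_arcsD1 T.in_arcsD2)
  then have "with_proj H = app_iso iso (with_proj T)"
    by (simp add: with_proj_def app_iso_def H_def iso_def)
  ultimately show ?thesis
    using assms(6) unfolding has_induced_rainbow_def digraph_iso_def
    by (intro exI[of _ H]) (auto simp: H_def)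
qed

theorem theorem21:
  fixes r s :: nat
    and G :: "'a pair_pre_digraph"
    and c :: "'a \<Rightarrow> 'c"
    and T :: "'t pair_pre_digraph"
  assumes "r \<ge> 2" and "s \<ge> 1"
    and "pair_graph G"
    and "K2_free r G"
    and "chromatic_number G \<ge> (r * s) ^ s"
    and "optimal_coloring G c"
    and "undirected_tree T" and "card (pverts T) = s"
  shows "has_induced_rainbow G c T"
proof -
  interpret G: pair_graph G by fact
  define k where "k = chromatic_number G"
  have proper: "proper_coloring G c" and card: "card (c ` pverts G) = k"
    using assms(6) by (auto simp: optimal_coloring_def k_def)
  have "finite (c ` pverts G)" using G.pair_finite_verts by simp
  \<comment> \<open>Colors have an arbitrary type; \<open>b\<close> renumbers them so that they can
    serve as heap nodes.\<close>
  then obtain b where b: "bij_betw b (c ` pverts G) {..<k}"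
    using ex_bij_betw_finite_nat card atLeast0LessThan by metis
  have "\<exists>f. \<forall>i<k. f i \<in> pverts G \<and> (b \<circ> c) (f i) = i \<and>
      (0 < i \<longrightarrow> (f ((i - 1) div (r * s)), f i) \<in> parcs G)"
  proof (rule ex_colorful_rooted_tree)
    show "sym (parcs G)" using G.arcs_symmetric by (auto intro: symI)
    show "(i - 1) div (r * s) < i" if "0 < i" "i < k" for i
      using that by (intro order.strict_trans1[OF div_le_dividend]) simp
    show "(b \<circ> c) u \<noteq> (b \<circ> c) v" if "u \<in> pverts G" "v \<in> pverts G" "(u, v) \<in> parcs G" for u v
    proof -
      have "c u \<noteq> c v" using proper that(3) by (auto simp: proper_coloring_def)
      then show ?thesis using b that(1,2) by (auto simp: bij_betw_def inj_on_def)
    qed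
    show "(b \<circ> c) ` pverts G \<subseteq> {..<k}" using b by (auto simp: bij_betw_def)
    show "\<exists>u\<in>pverts G. \<exists>v\<in>pverts G. (u, v) \<in> parcs G \<and> c' u = c' v"
      if "m < k" "c' ` pverts G \<subseteq> {..<m}" for m and c' :: "'a \<Rightarrow> nat"
    proof -
      \<comment> \<open>Here the minimality of the chromatic number enters.\<close>
      have "\<not> proper_coloring G c'"
        using not_less_Least[of m] that by (auto simp: k_def chromatic_number_def)
      then show ?thesis by (fastforce simp: proper_coloring_def dest: G.in_arcsD1 G.in_arcsD2)
    qed
  qed
  then obtain f where f: "\<And>i. i < k \<Longrightarrow> f i \<in> pverts G" "\<And>i. i < k \<Longrightarrow> b (c (f i)) = i"
    "\<And>i. 0 < i \<Longrightarrow> i < k \<Longrightarrow> (f ((i - 1) div (r * s)), f i) \<in> parcs G" by auto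
  have "2 \<le> r * s" using mult_le_mono[OF assms(1,2)] by simp
  moreover have "inj_on f {..<k}" using f(2) by (metis inj_onI lessThan_iff)
  moreover have "0 < r" using assms(1) by simp
  ultimately obtain h where h: "inj_on h (pverts T)" "h ` pverts T \<subseteq> f ` {..<k}"
    "\<forall>u\<in>pverts T. \<forall>w\<in>pverts T. (u, w) \<in> parcs T \<longleftrightarrow> (h u, h w) \<in> parcs G"
    using ex_induced_copy_in_heap[of G r T s k f] assms f(3) unfolding k_def by blast
  show ?thesis
  proof (rule has_induced_rainbowI)
    show "pair_graph T" using assms(7) by (simp add: undirected_tree_def)
    \<comment> \<open>The renumbered color of \<open>f i\<close> is \<open>i\<close>, so
      \<open>f \<circ> b\<close> recovers the vertex from its color.\<close>
    have "inj_on c (f ` {..<k})" by (rule inj_on_inverseI[where g = "f \<circ> b"]) (auto simp: f(2))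
    then show "inj_on c (h ` pverts T)" using h(2) by (rule inj_on_subset)
    show "h ` pverts T \<subseteq> pverts G" using h(2) f(1) by auto
  qed (use assms(3) h in auto)
qed

end
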